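(* For positive integers $a$ and $b$, let $S_{a,b}$ be the double star: the tree on $a+b+2$ vertices consisting of an edge $\{u,v\}$ together with $a$ further vertices adjacent only to $u$ and $b$ further vertices adjacent only to $v$ (so $|N(u)\setminus\{v\}|=a$, $|N(v)\setminus\{u\}|=b$, $N(u)\cap N(v)=\varnothing$). Then for every $n$, \[ \mathrm{ex}^c(n,S_{a,b})\le \frac{a+b}{2}\,n . \]
   Context: For a tree $T$, $\mathrm{ex}^c(n,T)$ denotes the maximum number of edges of an $n$-vertex graph $G$ that admits a proper vertex coloring (with any number of colors) such that in every copy of $T$ in $G$ (every subgraph of $G$ isomorphic to $T$), all leaves of that copy have the same color. *)

theory Defs
  imports Complex_Main
begin

type_synonym 'a graph = "'a set \<times> 'a set set"

abbreviation verts :: "'a graph \<Rightarrow> 'a set" where "verts \<equiv> fst"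
abbreviation edges :: "'a graph \<Rightarrow> 'a set set" where "edges \<equiv> snd"

definition simple_graph :: "'a graph \<Rightarrow> bool" where
  "simple_graph G \<longleftrightarrow> finite (verts G) \<and> (\<forall>e \<in> edges G. e \<subseteq> verts G \<and> card e = 2)"

definition subgraph :: "'a graph \<Rightarrow> 'a graph \<Rightarrow> bool" where
  "subgraph H G \<longleftrightarrow> simple_graph H \<and> verts H \<subseteq> verts G \<and> edges H \<subseteq> edges G"

definition isomorphic :: "'a graph \<Rightarrow> 'b graph \<Rightarrow> bool" where
  "isomorphic G H \<longleftrightarrow>
     (\<exists>f. bij_betw f (verts G) (verts H) \<and>
          (\<forall>x \<in> verts G. \<forall>y \<in> verts G. {x, y} \<in> edges G \<longleftrightarrow> {f x, f y} \<in> edges H))"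

definition copy_of :: "'b graph \<Rightarrow> 'a graph \<Rightarrow> 'a graph \<Rightarrow> bool" where
  "copy_of T G H \<longleftrightarrow> subgraph H G \<and> isomorphic T H"

definition degree :: "'a graph \<Rightarrow> 'a \<Rightarrow> nat" where
  "degree G v = card {e \<in> edges G. v \<in> e}"

definition leaves :: "'a graph \<Rightarrow> 'a set" where
  "leaves G = {v \<in> verts G. degree G v = 1}"

definition proper_coloring :: "'a graph \<Rightarrow> ('a \<Rightarrow> nat) \<Rightarrow> bool" where
  "proper_coloring G c \<longleftrightarrow>
     (\<forall>x \<in> verts G. \<forall>y \<in> verts G. {x, y} \<in> edges G \<longrightarrow> c x \<noteq> c y)"

definition leaf_monochromatic :: "'b graph \<Rightarrow> 'a graph \<Rightarrow> ('a \<Rightarrow> nat) \<Rightarrow> bool" where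
  "leaf_monochromatic T G c \<longleftrightarrow>
     (\<forall>H. copy_of T G H \<longrightarrow> (\<forall>x \<in> leaves H. \<forall>y \<in> leaves H. c x = c y))"

text \<open>
  Up to isomorphism, the graphs on \<open>n\<close> vertices are those with vertex set \<open>{..<n}\<close>, and
  colors in \<open>nat\<close> are enough for colorings of a finite graph with any number of colors.
\<close>

definition admissible_graphs :: "nat \<Rightarrow> 'b graph \<Rightarrow> nat graph set" where
  "admissible_graphs n T =
     {G. simple_graph G \<and> verts G = {..<n} \<and>
         (\<exists>c. proper_coloring G c \<and> leaf_monochromatic T G c)}"

definition ex_c :: "nat \<Rightarrow> 'b graph \<Rightarrow> nat" where
  "ex_c n T = Max ((\<lambda>G. card (edges G)) ` admissible_graphs n T)"

text \<open>The maximum is taken over a finite nonempty set, so it is attained.\<close>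

lemma finite_admissible_graphs: "finite (admissible_graphs n T)"
proof (rule finite_subset)
  show "admissible_graphs n T \<subseteq> {{..<n}} \<times> Pow (Pow {..<n})"
    unfolding admissible_graphs_def simple_graph_def by fastforce
qed auto

lemma edgeless_admissible: "({..<n}, {}) \<in> admissible_graphs n T"
  by (auto simp: admissible_graphs_def simple_graph_def proper_coloring_def
      leaf_monochromatic_def copy_of_def subgraph_def leaves_def degree_def)

text \<open>
  The centers are \<open>u = 0\<close> and \<open>v = 1\<close>; the \<open>a\<close> vertices \<open>2, \<dots>, a + 1\<close> are attached to \<open>u\<close> and
  the \<open>b\<close> vertices \<open>a + 2, \<dots>, a + b + 1\<close> to \<open>v\<close>.
\<close>

definition double_star :: "nat \<Rightarrow> nat \<Rightarrow> nat graph" where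
  "double_star a b =
     ({..<a + b + 2},
      {{0, 1}} \<union> (\<lambda>i. {0, i}) ` {2..<a + 2} \<union> (\<lambda>i. {1, i}) ` {a + 2..<a + b + 2})"

lemma simple_graph_double_star: "simple_graph (double_star a b)"
  by (auto simp: simple_graph_def double_star_def card_insert_if)

end

theory Submission
  imports Defs
begin

text \<open>
  By symmetry let \<open>a \<le> b\<close>. Deleting a vertex of degree at most \<open>(a + b) / 2\<close> preserves the
  hypotheses, so by induction all degrees may be assumed to be at least \<open>a + 1\<close>. If no degree
  exceeds \<open>a + b\<close>, the bound is the handshake lemma. Otherwise let \<open>u\<close> have at least
  \<open>a + b + 1\<close> neighbors. For every neighbor \<open>v\<close> of \<open>u\<close> and any \<open>a\<close> further neighbors \<open>A\<close> of
  \<open>v\<close>, each vertex of \<open>N(u) - {v}\<close> outside \<open>A\<close> is a leaf of some double star with centers \<open>u\<close>,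
  \<open>v\<close> that has the leaves \<open>A\<close> at \<open>v\<close>. Hence \<open>N(u) - {v}\<close> and \<open>A\<close> share one color. As \<open>u\<close> has
  at least three neighbors, this forces all of \<open>N(u)\<close> to have one color, so that \<open>v\<close> has the
  color of its neighbors in \<open>A\<close>, a contradiction.
\<close>

section \<open>Neighborhoods and the handshake identity\<close>

definition nbrs :: "'a graph \<Rightarrow> 'a \<Rightarrow> 'a set" where
  "nbrs G v = {w. {v, w} \<in> edges G}"

lemma simple_graphD:
  assumes "simple_graph G"
  shows "finite (verts G)" "\<And>e. e \<in> edges G \<Longrightarrow> e \<subseteq> verts G" "\<And>e. e \<in> edges G \<Longrightarrow> card e = 2"
    "finite (edges G)"
proof -
  show "finite (verts G)" and "\<And>e. e \<in> edges G \<Longrightarrow> e \<subseteq> verts G"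
    and "\<And>e. e \<in> edges G \<Longrightarrow> card e = 2"
    using assms by (auto simp: simple_graph_def)
  then have "edges G \<subseteq> Pow (verts G)" by blast
  then show "finite (edges G)"
    using \<open>finite (verts G)\<close> by (meson finite_Pow_iff finite_subset)
qed

lemma nbrs_sym: "w \<in> nbrs G v \<longleftrightarrow> v \<in> nbrs G w"
  by (simp add: nbrs_def insert_commute)

lemma not_in_nbrs_self: "simple_graph G \<Longrightarrow> v \<notin> nbrs G v"
  using simple_graphD(3) by (fastforce simp: nbrs_def)

lemma nbrs_subset: "simple_graph G \<Longrightarrow> nbrs G v \<subseteq> verts G"
  using simple_graphD(2) by (fastforce simp: nbrs_def)

lemma finite_nbrs: "simple_graph G \<Longrightarrow> finite (nbrs G v)"
  using nbrs_subset simple_graphD(1) by (metis finite_subset)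

lemma degree_eq_card_nbrs:
  assumes "simple_graph G"
  shows "degree G v = card (nbrs G v)"
proof -
  have "{e \<in> edges G. v \<in> e} = (\<lambda>w. {v, w}) ` nbrs G v"
  proof (intro equalityI subsetI)
    fix e assume e: "e \<in> {e \<in> edges G. v \<in> e}"
    then have "card e = 2" using simple_graphD(3)[OF assms] by auto
    then obtain x y where "e = {x, y}" by (auto simp: card_2_iff)
    with e show "e \<in> (\<lambda>w. {v, w}) ` nbrs G v"
      by (auto simp: nbrs_def insert_commute)
  qed (auto simp: nbrs_def)
  moreover have "inj_on (\<lambda>w. {v, w}) (nbrs G v)"
    by (auto simp: inj_on_def doubleton_eq_iff)
  ultimately show ?thesis by (simp add: degree_def card_image)
qed

lemma handshake:
  assumes "simple_graph G"
  shows "(\<Sum>v\<in>verts G. degree G v) = 2 * card (edges G)"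
proof -
  note G = simple_graphD[OF assms]
  \<comment> \<open>Incident pairs are counted twice: each edge contributes its own size, the
    constant 2 that \<open>sum_multicount\<close> asks for.\<close>
  have "{v \<in> verts G. v \<in> e} = e" if "e \<in> edges G" for e
    using G(2)[OF that] by auto
  then show ?thesis
    unfolding degree_def using G by (intro sum_multicount) auto
qed

section \<open>Copies as injective images\<close>

lemma copy_of_image:
  assumes T: "simple_graph T" and inj: "inj_on f (verts T)"
    and vs: "f ` verts T \<subseteq> verts G" and es: "\<And>e. e \<in> edges T \<Longrightarrow> f ` e \<in> edges G"
  defines "H \<equiv> (f ` verts T, (`) f ` edges T)"
  shows "copy_of T G H" "f ` leaves T \<subseteq> leaves H"
proof -
  note T' = simple_graphD[OF T]
  \<comment> \<open>Copies need not be induced, so \<open>H\<close> keeps only the images of edges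
    of \<open>T\<close>. By injectivity no non-edge of \<open>T\<close> lands on one of them, so
    \<open>f\<close> also reflects edges.\<close>
  have mem: "f ` s \<in> edges H \<longleftrightarrow> s \<in> edges T" if "s \<subseteq> verts T" for s
    using that inj_on_image_eq_iff[OF inj] T'(2) unfolding H_def by fastforce
  have "simple_graph H"
    using T' inj unfolding simple_graph_def H_def
    by (auto simp: card_image inj_on_subset intro!: image_mono)
  moreover have "isomorphic T H"
    unfolding isomorphic_def
  proof (intro exI[of _ f] conjI ballI)
    show "bij_betw f (verts T) (verts H)"
      using inj by (simp add: H_def bij_betw_def)
    show "{x, y} \<in> edges T \<longleftrightarrow> {f x, f y} \<in> edges H" if "x \<in> verts T" "y \<in> verts T" for x y
      using mem[of "{x, y}"] that by simp
  qed
  ultimately show "copy_of T G H"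
    using vs es by (auto simp: copy_of_def subgraph_def H_def)
  \<comment> \<open>Degrees are taken in \<open>H\<close>, not in \<open>G\<close>, so
    \<open>f\<close> preserves them and sends leaves to leaves.\<close>
  have "degree H (f x) = degree T x" if x: "x \<in> verts T" for x
  proof -
    have "f x \<in> f ` e \<longleftrightarrow> x \<in> e" if "e \<in> edges T" for e
      using inj_on_image_mem_iff[OF inj x] T'(2)[OF that] by auto
    then have "{e \<in> edges H. f x \<in> e} = (`) f ` {e \<in> edges T. x \<in> e}"
      by (auto simp: H_def)
    moreover have "inj_on ((`) f) {e \<in> edges T. x \<in> e}"
      using inj_on_image_eq_iff[OF inj] T'(2) by (auto intro!: inj_onI)
    ultimately show ?thesis by (simp add: degree_def card_image)
  qed
  then show "f ` leaves T \<subseteq> leaves H"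
    by (auto simp: leaves_def H_def)
qed

section \<open>Double stars given by centers and leaf sets\<close>

lemma leaves_double_star: "{2..<a + b + 2} \<subseteq> leaves (double_star a b)"
proof
  fix i assume i: "i \<in> {2..<a + b + 2}"
  have "{e \<in> edges (double_star a b). i \<in> e} = {if i < a + 2 then {0, i} else {1, i}}"
    using i by (auto simp: double_star_def)
  then show "i \<in> leaves (double_star a b)"
    using i by (simp add: leaves_def degree_def double_star_def)
qed

text \<open>Replaces copies and isomorphisms by two centers \<open>u\<close>, \<open>v\<close> with
  disjoint leaf sets \<open>A\<close>, \<open>B\<close>. In this form the hypothesis passes easily
  to subgraphs and is symmetric in the two sides.\<close>

definition double_stars_monochromatic :: "nat \<Rightarrow> nat \<Rightarrow> 'a graph \<Rightarrow> ('a \<Rightarrow> nat) \<Rightarrow> bool" where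
  "double_stars_monochromatic a b G c \<longleftrightarrow>
     (\<forall>u v A B. v \<in> nbrs G u \<and> A \<subseteq> nbrs G u - {v} \<and> B \<subseteq> nbrs G v - {u} \<and> A \<inter> B = {} \<and>
        card A = a \<and> card B = b \<longrightarrow> (\<forall>x \<in> A \<union> B. \<forall>y \<in> A \<union> B. c x = c y))"

text \<open>Exchanging the centers is the symmetry that allows \<open>a \<le> b\<close> to be
  assumed.\<close>

lemma double_stars_monochromatic_commute:
  assumes "double_stars_monochromatic a b G c"
  shows "double_stars_monochromatic b a G c"
  unfolding double_stars_monochromatic_def
proof (intro allI impI)
  fix u v A B
  assume "v \<in> nbrs G u \<and> A \<subseteq> nbrs G u - {v} \<and> B \<subseteq> nbrs G v - {u} \<and> A \<inter> B = {} \<and>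
    card A = b \<and> card B = a"
  then have "u \<in> nbrs G v \<and> B \<subseteq> nbrs G v - {u} \<and> A \<subseteq> nbrs G u - {v} \<and> B \<inter> A = {} \<and>
    card B = a \<and> card A = b"
    by (auto simp: nbrs_sym)
  with assms have "\<forall>x \<in> B \<union> A. \<forall>y \<in> B \<union> A. c x = c y"
    unfolding double_stars_monochromatic_def by blast
  then show "\<forall>x \<in> A \<union> B. \<forall>y \<in> A \<union> B. c x = c y" by blast
qed

text \<open>Used for deleting a vertex: double stars of the smaller graph survive in the larger
  one.\<close>

lemma double_stars_monochromatic_mono:
  assumes "double_stars_monochromatic a b G c" and "edges H \<subseteq> edges G"
  shows "double_stars_monochromatic a b H c"
  unfolding double_stars_monochromatic_def
proof (intro allI impI)
  have nbrs: "nbrs H v \<subseteq> nbrs G v" for v using assms(2) by (auto simp: nbrs_def)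
  fix u v A B
  assume "v \<in> nbrs H u \<and> A \<subseteq> nbrs H u - {v} \<and> B \<subseteq> nbrs H v - {u} \<and> A \<inter> B = {} \<and>
    card A = a \<and> card B = b"
  then have "v \<in> nbrs G u \<and> A \<subseteq> nbrs G u - {v} \<and> B \<subseteq> nbrs G v - {u} \<and> A \<inter> B = {} \<and>
    card A = a \<and> card B = b"
    using nbrs[of u] nbrs[of v] by auto
  with assms(1) show "\<forall>x \<in> A \<union> B. \<forall>y \<in> A \<union> B. c x = c y"
    unfolding double_stars_monochromatic_def by blast
qed

text \<open>The map \<open>f\<close> sends 0 and 1 to the centers and the two blocks of outer
  vertices onto \<open>A\<close> and \<open>B\<close>; its image is a copy having all of
  \<open>A \<union> B\<close> among its leaves.\<close>

lemma leaf_monochromatic_imp_double_stars_monochromatic: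
  assumes G: "simple_graph G" and lm: "leaf_monochromatic (double_star a b) G c"
  shows "double_stars_monochromatic a b G c"
  unfolding double_stars_monochromatic_def
proof (intro allI impI, elim conjE)
  fix u v A B
  assume uv: "v \<in> nbrs G u" and A: "A \<subseteq> nbrs G u - {v}" and B: "B \<subseteq> nbrs G v - {u}"
    and disj: "A \<inter> B = {}" and cA: "card A = a" and cB: "card B = b"
  have "finite A" "finite B"
    using A B finite_nbrs[OF G] by (meson finite_Diff finite_subset)+
  then obtain g h where g: "bij_betw g {2..<a + 2} A" and h: "bij_betw h {a + 2..<a + b + 2} B"
    using finite_same_card_bij[of "{2..<a + 2}" A] finite_same_card_bij[of "{a + 2..<a + b + 2}" B]
      cA cB by auto
  define f where "f i = (if i = 0 then u else if i = 1 then v else if i < a + 2 then g i else h i)"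
    for i :: nat
  have fA: "bij_betw f {2..<a + 2} A"
    using g by (rule bij_betw_cong[THEN iffD1, rotated]) (auto simp: f_def)
  have fB: "bij_betw f {a + 2..<a + b + 2} B"
    using h by (rule bij_betw_cong[THEN iffD1, rotated]) (auto simp: f_def)
  \<comment> \<open>The absence of loops makes the centers distinct and keeps each out of its own
    leaf set, so the pieces of \<open>f\<close> fit together injectively.\<close>
  have "u \<noteq> v" and uA: "u \<notin> A" and vB: "v \<notin> B"
    using uv A B not_in_nbrs_self[OF G] by auto
  then have f01: "bij_betw f {0, 1} {u, v}"
    by (auto simp: f_def bij_betw_def)
  have fAB: "bij_betw f ({2..<a + 2} \<union> {a + 2..<a + b + 2}) (A \<union> B)"
    using fA fB disj by (rule bij_betw_combine)
  have "bij_betw f ({0, 1} \<union> ({2..<a + 2} \<union> {a + 2..<a + b + 2})) ({u, v} \<union> (A \<union> B))"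
    using f01 fAB by (rule bij_betw_combine) (use uA vB A B in auto)
  moreover have "{0, 1} \<union> ({2..<a + 2} \<union> {a + 2..<a + b + 2}) = verts (double_star a b)"
    by (auto simp: double_star_def)
  ultimately have f: "bij_betw f (verts (double_star a b)) ({u, v} \<union> (A \<union> B))" by simp
  have "f ` verts (double_star a b) \<subseteq> verts G"
    using bij_betw_imp_surj_on[OF f] uv A B nbrs_subset[OF G, of u] nbrs_subset[OF G, of v]
      nbrs_sym[of v G u] by auto
  moreover have "f ` e \<in> edges G" if "e \<in> edges (double_star a b)" for e
  proof -
    have "f i \<in> nbrs G u" if "i \<in> {2..<a + 2}" for i
      using bij_betwE[OF fA] that A by blast
    moreover have "f i \<in> nbrs G v" if "i \<in> {a + 2..<a + b + 2}" for i
      using bij_betwE[OF fB] that B by blast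
    moreover have "f 0 = u" "f 1 = v" by (simp_all add: f_def)
    ultimately show ?thesis
      using that uv by (auto simp: double_star_def nbrs_def)
  qed
  ultimately obtain H where "copy_of (double_star a b) G H"
    and fH: "f ` leaves (double_star a b) \<subseteq> leaves H"
    using copy_of_image[OF simple_graph_double_star bij_betw_imp_inj_on[OF f]] by metis
  then have mono: "\<forall>x \<in> leaves H. \<forall>y \<in> leaves H. c x = c y"
    using lm unfolding leaf_monochromatic_def by blast
  have "A \<union> B = f ` ({2..<a + 2} \<union> {a + 2..<a + b + 2})"
    using fAB by (simp add: bij_betw_def)
  also have "{2..<a + 2} \<union> {a + 2..<a + b + 2} = {2..<a + b + 2}" by auto
  finally have "A \<union> B \<subseteq> leaves H"
    using fH leaves_double_star[of a b] by blast
  with mono show "\<forall>x \<in> A \<union> B. \<forall>y \<in> A \<union> B. c x = c y" by blast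
qed

section \<open>Excluding vertices of large degree\<close>

lemma no_vertex_of_large_degree:
  assumes G: "simple_graph G" and c: "proper_coloring G c"
    and mono: "double_stars_monochromatic a b G c"
    and a: "a \<ge> 1" and b: "b \<ge> 1"
    and large: "\<And>v. v \<in> verts G \<Longrightarrow> card (nbrs G v) \<ge> a + 1"
  shows "card (nbrs G u) \<le> a + b"
proof (rule ccontr)
  assume "\<not> ?thesis"
  then have u: "card (nbrs G u) \<ge> a + b + 1" by simp
  note fin = finite_nbrs[OF G]
  \<comment> \<open>The common color is named by some \<open>x\<close> adjacent to \<open>v\<close>,
    since this adjacency yields the final clash with properness.\<close>
  have key: "\<exists>x \<in> nbrs G v. \<forall>w \<in> nbrs G u - {v}. c w = c x" if v: "v \<in> nbrs G u" for v
  proof -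
    have "a + 1 \<le> card (nbrs G v)"
      using large v nbrs_subset[OF G] by blast
    then have "a \<le> card (nbrs G v - {u})"
      using v nbrs_sym[of v G u] by (simp add: fin)
    then obtain A where A: "A \<subseteq> nbrs G v - {u}" "card A = a" and "finite A"
      by (rule obtain_subset_with_card_n)
    then obtain x where x: "x \<in> A" using a by fastforce
    \<comment> \<open>Leaves for \<open>u\<close> drawn from \<open>M\<close> cannot meet those at
      \<open>v\<close>; removing \<open>A\<close> costs at most \<open>a\<close> of the at least
      \<open>a + b\<close> candidates.\<close>
    define M where "M = nbrs G u - {v} - A"
    have "card (nbrs G u - {v}) \<ge> a + b" using u v fin by simp
    then have M: "card M \<ge> b"
      using diff_card_le_card_Diff[OF \<open>finite A\<close>, of "nbrs G u - {v}"] A(2) by (simp add: M_def)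
    have "c w = c x" if w: "w \<in> nbrs G u - {v}" for w
    proof -
      \<comment> \<open>\<open>w\<close> becomes a leaf: either it is already in \<open>A\<close>,
        or \<open>B\<close> is chosen around it, which takes \<open>b \<ge> 1\<close>.\<close>
      obtain B where B: "B \<subseteq> M" "card B = b" "w \<in> A \<union> B"
      proof (cases "w \<in> A")
        case True
        obtain B where "B \<subseteq> M" "card B = b"
          using M by (rule obtain_subset_with_card_n)
        with True that show ?thesis by blast
      next
        case False
        then have "w \<in> M" using w by (simp add: M_def)
        then obtain B where "{w} \<subseteq> B" "B \<subseteq> M" "card B = b"
          using exists_subset_between[of "{w}" b M] M b fin by (auto simp: M_def)
        with that show ?thesis by blast
      qed
      \<comment> \<open>Here \<open>v\<close> is the first center: only \<open>a\<close> neighbors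
        besides \<open>u\<close> are guaranteed there, so \<open>v\<close> carries the
        \<open>a\<close> leaves and \<open>u\<close> the \<open>b\<close> leaves.\<close>
      then have "u \<in> nbrs G v \<and> A \<subseteq> nbrs G v - {u} \<and> B \<subseteq> nbrs G u - {v} \<and> A \<inter> B = {} \<and>
          card A = a \<and> card B = b"
        using A v by (auto simp: M_def nbrs_sym)
      with mono have "\<forall>x \<in> A \<union> B. \<forall>y \<in> A \<union> B. c x = c y"
        unfolding double_stars_monochromatic_def by blast
      with B x show ?thesis by blast
    qed
    with x A show ?thesis by blast
  qed
  \<comment> \<open>The third neighbor \<open>w'\<close> lies in both \<open>nbrs G u - {v}\<close>
    and \<open>nbrs G u - {w}\<close>, so it links the color of \<open>v\<close> to that of
    \<open>x\<close>.\<close>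
  have "card (nbrs G u) \<ge> 3" using u a b by simp
  then obtain S where "S \<subseteq> nbrs G u" "card S = 3" by (meson obtain_subset_with_card_n)
  then obtain v w w' where S: "{v, w, w'} \<subseteq> nbrs G u" "v \<noteq> w" "v \<noteq> w'" "w \<noteq> w'"
    by (auto simp: card_3_iff)
  obtain x where x: "x \<in> nbrs G v" "\<forall>z \<in> nbrs G u - {v}. c z = c x" using key S by blast
  obtain y where y: "\<forall>z \<in> nbrs G u - {w}. c z = c y" using key S by blast
  have "c v = c w'" using y S by auto
  also have "c w' = c x" using x S by auto
  finally have "c v = c x" .
  moreover have "c v \<noteq> c x"
    using c x(1) simple_graphD(2)[OF G, of "{v, x}"] by (simp add: proper_coloring_def nbrs_def)
  ultimately show False by simp
qed

section \<open>Induction on the number of vertices\<close>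

lemma card_edges_le_aux:
  assumes "simple_graph G" and "proper_coloring G c" and "double_stars_monochromatic a b G c"
    and a: "a \<ge> 1" and ab: "a \<le> b"
  shows "2 * card (edges G) \<le> (a + b) * card (verts G)"
  using assms(1-3)
proof (induction "card (verts G)" arbitrary: G rule: less_induct)
  case less
  note G = simple_graphD[OF less.prems(1)]
  show ?case
  proof (cases "\<exists>v \<in> verts G. 2 * degree G v \<le> a + b")
    case True
    then obtain v where v: "v \<in> verts G" and dv: "2 * degree G v \<le> a + b" by blast
    \<comment> \<open>The coloring \<open>c\<close> is kept. Twice the number of lost edges is at
      most \<open>a + b\<close>, the share of one vertex in the bound.\<close>
    define H where "H = (verts G - {v}, {e \<in> edges G. v \<notin> e})"
    have H: "simple_graph H" "proper_coloring H c" "double_stars_monochromatic a b H c"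
      using less.prems(1,2) double_stars_monochromatic_mono[OF less.prems(3), of H]
      by (auto simp: simple_graph_def proper_coloring_def H_def)
    have cV: "card (verts G) = Suc (card (verts H))"
      using card_Suc_Diff1[OF G(1) v] by (simp add: H_def)
    have "edges G = {e \<in> edges G. v \<in> e} \<union> edges H" "{e \<in> edges G. v \<in> e} \<inter> edges H = {}"
      by (auto simp: H_def)
    then have "card (edges G) = degree G v + card (edges H)"
      using G(4) simple_graphD(4)[OF H(1)] unfolding degree_def
      by (metis (no_types, lifting) card_Un_disjoint finite_Un)
    moreover have "2 * card (edges H) \<le> (a + b) * card (verts H)"
      using less.hyps[OF _ H] cV by simp
    ultimately show ?thesis using dv cV by simp
  next
    case False
    \<comment> \<open>Here \<open>a \<le> b\<close> enters: a degree above
      \<open>(a + b) / 2\<close> exceeds \<open>a\<close>.\<close>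
    then have "card (nbrs G v) \<ge> a + 1" if "v \<in> verts G" for v
      using that ab degree_eq_card_nbrs[OF less.prems(1), of v] by fastforce
    then have "degree G v \<le> a + b" for v
      using no_vertex_of_large_degree[OF less.prems a] a ab
        degree_eq_card_nbrs[OF less.prems(1)] by simp
    then have "(\<Sum>v\<in>verts G. degree G v) \<le> (a + b) * card (verts G)"
      using sum_bounded_above[of "verts G" "degree G" "a + b"] by (simp add: mult.commute)
    then show ?thesis using handshake[OF less.prems(1)] by simp
  qed
qed

lemma card_edges_le:
  assumes "simple_graph G" and "proper_coloring G c" and "double_stars_monochromatic a b G c"
    and "a \<ge> 1" and "b \<ge> 1"
  shows "2 * card (edges G) \<le> (a + b) * card (verts G)"
proof (cases "a \<le> b")
  case True
  then show ?thesis using card_edges_le_aux assms by blast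
next
  case False
  then show ?thesis
    using card_edges_le_aux[OF assms(1,2) double_stars_monochromatic_commute[OF assms(3)]] assms(5)
    by (simp add: add.commute)
qed

theorem theorem9:
  fixes a b n :: nat
  assumes "a \<ge> 1" and "b \<ge> 1"
  shows "real (ex_c n (double_star a b)) \<le> (real a + real b) / 2 * real n"
proof -
  let ?Adm = "admissible_graphs n (double_star a b)"
  have "ex_c n (double_star a b) \<in> (\<lambda>G. card (edges G)) ` ?Adm"
    unfolding ex_c_def using finite_admissible_graphs edgeless_admissible
    by (intro Max_in) blast+
  then obtain G c where "simple_graph G" "verts G = {..<n}" "proper_coloring G c"
      "leaf_monochromatic (double_star a b) G c" "ex_c n (double_star a b) = card (edges G)"
    by (auto simp: admissible_graphs_def)
  \<comment> \<open>The doubled bound stays in \<open>nat\<close>; halving waits for the passage to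
    the reals.\<close>
  then have "2 * ex_c n (double_star a b) \<le> (a + b) * n"
    using card_edges_le leaf_monochromatic_imp_double_stars_monochromatic assms
    by (metis card_lessThan)
  then have "real (2 * ex_c n (double_star a b)) \<le> real ((a + b) * n)"
    by (simp only: of_nat_le_iff)
  then show ?thesis by simp
qed

end
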